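(* Let $\varepsilon,l,c\in\mathbb{R}$ satisfy $\varepsilon\in(0,1)$, $\max(\varepsilon,1-\varepsilon)<l<1$, $-l<c\le 0$, and suppose moreover that $\varepsilon\notin\mathbb{Q}$ and $l\notin\mathbb{Z}+\mathbb{Z}\varepsilon$. Let $u=(u_n)_{n\in\mathbb{N}}$ be the (non-degenerate) 3iet word with parameters $\varepsilon,l,c$. Let $\varphi$ be a primitive substitution over $\{A,B,C\}$ such that $\varphi(u)=u$. Then $\varepsilon$ is a Sturm number.
   Context: 3iet word: put $I_A=[c,c+\varepsilon+l-1)$, $I_B=[c+\varepsilon+l-1,c+\varepsilon)$, $I_C=[c+\varepsilon,c+l)$, $I=I_A\cup I_B\cup I_C$, and let $T:I\to I$ be the exchange of three intervals with permutation $(321)$: $T(x)=x+1-\varepsilon$ on $I_A$, $T(x)=x+1-2\varepsilon$ on $I_B$, $T(x)=x-\varepsilon$ on $I_C$. The 3iet word with parameters $\varepsilon,l,c$ is the infinite word $u=(u_n)_{n\in\mathbb{N}}$ over $\{A,B,C\}$ with $u_n=X$ if and only if $T^n(0)\in I_X$. (In terms of the lengths $\alpha,\beta,\gamma$ of $I_A,I_B,I_C$, normalized by $\alpha+2\beta+\gamma=1$, one has $\varepsilon=\alpha+\beta$ and $l=\alpha+\beta+\gamma$.) A substitution over $\mathcal{A}=\{A,B,C\}$ is a monoid morphism $\varphi:\mathcal{A}^*\to\mathcal{A}^*$ such that no letter has empty image; it acts on infinite words by $\varphi(u_0u_1\cdots)=\varphi(u_0)\varphi(u_1)\cdots$. Its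 incidence matrix is $(\boldsymbol{M}_\varphi)_{ij}=|\varphi(a_i)|_{a_j}$, the number of occurrences of $a_j$ in $\varphi(a_i)$, where $(a_1,a_2,a_3)=(A,B,C)$. It is primitive if some power $\boldsymbol{M}_\varphi^k$ has all entries positive. Sturm number: a quadratic irrational number $\varepsilon$ with algebraic conjugate $\varepsilon'$ such that $\varepsilon\in(0,1)$ and $\varepsilon'\notin(0,1)$. *)

theory Defs
  imports
    "HOL-Analysis.Analysis"
    "HOL-Computational_Algebra.Polynomial_Factorial"
    "HOL-Library.Stream"
begin

datatype letter = LA | LB | LC

lemma UNIV_letter: "UNIV = {LA, LB, LC}"
  using letter.exhaust by auto

instance letter :: finite
  by standard (simp add: UNIV_letter)

fun iet_interval :: "real \<Rightarrow> real \<Rightarrow> real \<Rightarrow> letter \<Rightarrow> real set" where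
  "iet_interval \<epsilon> l c LA = {c ..< c + \<epsilon> + l - 1}"
| "iet_interval \<epsilon> l c LB = {c + \<epsilon> + l - 1 ..< c + \<epsilon>}"
| "iet_interval \<epsilon> l c LC = {c + \<epsilon> ..< c + l}"

text \<open>Only the values on the union of the three intervals, which is mapped into
  itself, are meaningful.\<close>

definition iet_map :: "real \<Rightarrow> real \<Rightarrow> real \<Rightarrow> real \<Rightarrow> real" where
  "iet_map \<epsilon> l c x =
     (if x \<in> iet_interval \<epsilon> l c LA then x + 1 - \<epsilon>
      else if x \<in> iet_interval \<epsilon> l c LB then x + 1 - 2 * \<epsilon>
      else if x \<in> iet_interval \<epsilon> l c LC then x - \<epsilon>
      else undefined)"

definition is_3iet_word :: "real \<Rightarrow> real \<Rightarrow> real \<Rightarrow> letter stream \<Rightarrow> bool" where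
  "is_3iet_word \<epsilon> l c u \<longleftrightarrow>
     (\<forall>n X. u !! n = X \<longleftrightarrow> (iet_map \<epsilon> l c ^^ n) 0 \<in> iet_interval \<epsilon> l c X)"

lemma is_3iet_word_exists1:
  assumes "max \<epsilon> (1 - \<epsilon>) < l" "l < 1" "- l < c" "c \<le> 0"
  shows "\<exists>!u. is_3iet_word \<epsilon> l c u"
proof -
  let ?T = "iet_map \<epsilon> l c" and ?I = "iet_interval \<epsilon> l c"
  have part: "\<exists>!X. x \<in> ?I X" if "x \<in> {c ..< c + l}" for x
  proof -
    have "x \<in> ?I LA \<or> x \<in> ?I LB \<or> x \<in> ?I LC"
      using that by auto
    then consider "x \<in> ?I LA" | "x \<in> ?I LB" | "x \<in> ?I LC"
      by blast
    then show ?thesis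
    proof cases
      case 1
      have "X = LA" if "x \<in> ?I X" for X
        using 1 that assms by (cases X) auto
      with 1 show ?thesis by blast
    next
      case 2
      have "X = LB" if "x \<in> ?I X" for X
        using 2 that assms by (cases X) auto
      with 2 show ?thesis by blast
    next
      case 3
      have "X = LC" if "x \<in> ?I X" for X
        using 3 that assms by (cases X) auto
      with 3 show ?thesis by blast
    qed
  qed
  have orbit: "(?T ^^ n) 0 \<in> {c ..< c + l}" for n
  proof (induction n)
    case 0
    show ?case using assms by simp
  next
    case (Suc n)
    then show ?case using assms by (auto simp: iet_map_def)
  qed
  define u where "u = smap (\<lambda>n. THE X. (?T ^^ n) 0 \<in> ?I X) (fromN 0)"
  have u: "(?T ^^ n) 0 \<in> ?I (u !! n)" for n
    using theI'[OF part[OF orbit[of n]]] by (simp add: u_def)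
  show ?thesis
  proof (rule ex1I[of _ u])
    show "is_3iet_word \<epsilon> l c u"
      unfolding is_3iet_word_def using u part[OF orbit] by blast
  next
    fix v assume "is_3iet_word \<epsilon> l c v"
    then have "(?T ^^ n) 0 \<in> ?I (v !! n)" for n
      unfolding is_3iet_word_def by blast
    then have "v !! n = u !! n" for n
      using u part[OF orbit] by blast
    then have "snth v = snth u"
      by (rule ext)
    then show "v = u"
      by (metis stream_smap_nats)
  qed
qed

definition substitution :: "(letter list \<Rightarrow> letter list) \<Rightarrow> bool" where
  "substitution \<phi> \<longleftrightarrow>
     \<phi> [] = [] \<and> (\<forall>v w. \<phi> (v @ w) = \<phi> v @ \<phi> w) \<and> (\<forall>a. \<phi> [a] \<noteq> [])"

text \<open>The constant \<open>flat\<close> concatenates a stream of lists; it is only meaningful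
  if all of these lists are nonempty.\<close>

definition subst_stream :: "(letter list \<Rightarrow> letter list) \<Rightarrow> letter stream \<Rightarrow> letter stream" where
  "subst_stream \<phi> u = flat (smap (\<lambda>a. \<phi> [a]) u)"

definition incidence_matrix :: "(letter list \<Rightarrow> letter list) \<Rightarrow> nat ^ letter ^ letter" where
  "incidence_matrix \<phi> = (\<chi> i j. count_list (\<phi> [i]) j)"

definition matrix_power :: "'a::semiring_1 ^ 'n ^ 'n \<Rightarrow> nat \<Rightarrow> 'a ^ 'n ^ 'n" where
  "matrix_power M k = (((**) M) ^^ k) (mat 1)"

definition primitive_substitution :: "(letter list \<Rightarrow> letter list) \<Rightarrow> bool" where
  "primitive_substitution \<phi> \<longleftrightarrow> substitution \<phi> \<and>
     (\<exists>k. \<forall>i j. matrix_power (incidence_matrix \<phi>) k $ i $ j > 0)"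

text \<open>\<open>x\<close> is a quadratic irrational with algebraic conjugate \<open>x'\<close>: they are the two
  distinct roots of an irreducible quadratic polynomial over the rationals. As \<open>x\<close> is
  real, so is its conjugate.\<close>

definition quadratic_conjugates :: "real \<Rightarrow> real \<Rightarrow> bool" where
  "quadratic_conjugates x x' \<longleftrightarrow> x \<noteq> x' \<and>
     (\<exists>p :: rat poly. irreducible p \<and> degree p = 2 \<and>
        poly (map_poly of_rat p) x = 0 \<and> poly (map_poly of_rat p) x' = 0)"

definition sturm_number :: "real \<Rightarrow> bool" where
  "sturm_number x \<longleftrightarrow> x \<in> {0<..<1} \<and>
     (\<exists>x'. quadratic_conjugates x x' \<and> x' \<notin> {0<..<1})"

end

theory Submission
  imports Defs "HOL-Analysis.Kronecker_Approximation_Theorem"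
begin

text \<open>
  Replace \<open>\<phi>\<close> by a power whose incidence matrix \<open>M\<close> has only positive entries.
  The \<open>n\<close>-th point of the orbit of \<open>0\<close> is the weight of the prefix of length \<open>n\<close> of \<open>u\<close> under
  \<open>t = (1 - \<epsilon>, 1 - 2\<epsilon>, - \<epsilon>)\<close>, so \<open>t\<close> has bounded prefix weights; as \<open>\<phi>\<close> maps prefixes to prefixes,
  so does \<open>M t\<close>. The key point is that a weight vector \<open>v\<close> with bounded prefix weights satisfies
  \<open>v\<^sub>B = v\<^sub>A + v\<^sub>C\<close>. Indeed, \<open>T\<close> is induced by the rotation by \<open>- \<epsilon>\<close> on the circle, and the
  prefix weights become Birkhoff sums of a step function whose jump at \<open>l\<close> is \<open>v\<^sub>B - v\<^sub>A - v\<^sub>C\<close>.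
  Bounded sums vary little on the visits to some short interval. Two orbit points just left and just
  right of \<open>l\<close> can be followed both backwards and forwards into this interval, and, as \<open>l\<close> is not in
  \<open>\<int> + \<int>\<epsilon>\<close>, they cross no other discontinuity on different sides; hence the two sums
  differ by exactly the jump, which must vanish.

  It follows that \<open>M t = \<lambda> t\<close>, which is a quadratic equation for \<open>\<epsilon>\<close> over the integers, and
  \<open>M t' = \<lambda>' t'\<close> for the conjugates. The entries of \<open>M\<^sup>k t\<close> are bounded, whereas those of
  \<open>M\<^sup>k t' = M\<^sup>k t + (\<epsilon> - \<epsilon>') M\<^sup>k (1, 2, 1)\<close> tend to infinity, all with the same sign. So
  \<open>1 - \<epsilon>'\<close> and \<open>- \<epsilon>'\<close> have the same sign.
\<close>

section \<open>Birkhoff sums of a step function over an irrational rotation\<close>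

lemma irrational_rotation_hits_interval:
  fixes \<theta> y a b :: real
  assumes "\<theta> \<notin> \<rat>" "a < b"
  obtains n :: nat and h :: int where "n \<ge> M" "a < y + n * \<theta> + h" "y + n * \<theta> + h < b"
proof -
  have "(b - a) / 2 > 0"
    using assms(2) by simp
  \<comment> \<open>The target is the midpoint of the interval, seen after \<open>M\<close> steps
    have already been made. Positivity of \<open>k\<close> then gives a time beyond
    \<open>M\<close>.\<close>
  then obtain h k :: int where "k > 0"
    and hk: "\<bar>of_int k * \<theta> - of_int h - ((a + b) / 2 - y - M * \<theta>)\<bar> < (b - a) / 2"
    by (rule sequence_of_fractional_parts_is_dense[OF assms(1)])
  have "real (M + nat k) * \<theta> = M * \<theta> + of_int k * \<theta>"
    using \<open>k > 0\<close> by (simp add: algebra_simps)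
  then show thesis
    using that[of "M + nat k" "- h"] hk by (simp add: abs_less_iff) argo
qed

text \<open>A step function on the circle of length 1 with possible jumps only at 0,
  \<open>\<epsilon>\<close> and \<open>l\<close>. The pieces are closed on the left, which makes it
  right-continuous everywhere.\<close>

definition step3 :: "real \<Rightarrow> real \<Rightarrow> real \<Rightarrow> real \<Rightarrow> real \<Rightarrow> real \<Rightarrow> real" where
  "step3 \<epsilon> l a b d y = (if frac y < \<epsilon> then a else if frac y < l then b else d)"

lemma step3_add_of_int [simp]: "step3 \<epsilon> l a b d (y + of_int h) = step3 \<epsilon> l a b d y"
  by (simp add: step3_def)

section \<open>Local constancy of the step function\<close>

lemma eventually_frac_add_right:
  "\<forall>\<^sub>F e in at_right (0::real). frac (y + e) = frac y + e"
proof -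
  have "\<forall>\<^sub>F e in at_right (0::real). 0 < e \<and> e < 1 - frac y"
    using frac_lt_1[of y] by (auto simp: eventually_at_right_field intro!: exI[of _ "1 - frac y"])
  then show ?thesis
  proof eventually_elim
    case (elim e)
    have "y + e - (frac y + e) \<in> \<int>"
      by (simp add: frac_def)
    then show ?case
      using elim by (subst frac_unique_iff) (auto simp: add_nonneg_nonneg)
  qed
qed

lemma eventually_frac_add:
  assumes "y \<notin> \<int>"
  shows "\<forall>\<^sub>F e in at (0::real). frac (y + e) = frac y + e"
proof -
  have "\<forall>\<^sub>F e in at (0::real). - frac y < e \<and> e < 1 - frac y"
    using frac_lt_1[of y] assms
    by (auto intro!: eventually_conj order_tendstoD[OF tendsto_ident_at])
  then show ?thesis
  proof eventually_elim
    case (elim e)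
    have "y + e - (frac y + e) \<in> \<int>"
      by (simp add: frac_def)
    then show ?case
      using elim by (subst frac_unique_iff) auto
  qed
qed

lemma eventually_step3_add_right:
  "\<forall>\<^sub>F e in at_right (0::real). step3 \<epsilon> l a b d (y + e) = step3 \<epsilon> l a b d y"
proof -
  have less: "\<forall>\<^sub>F e in at_right (0::real). frac y + e < t \<longleftrightarrow> frac y < t" for t
  proof (cases "frac y < t")
    case True
    then have "\<forall>\<^sub>F e in at_right (0::real). e < t - frac y"
      by (auto simp: eventually_at_right_field intro: exI[of _ "t - frac y"])
    then show ?thesis
      by eventually_elim (use True in auto)
  next
    case False
    have "\<forall>\<^sub>F e in at_right (0::real). 0 < e"
      by (rule eventually_at_right_less)
    then show ?thesis
      by eventually_elim (use False in auto)
  qed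
  show ?thesis
    using eventually_frac_add_right[of y] less[of \<epsilon>] less[of l]
    by eventually_elim (simp add: step3_def)
qed

lemma eventually_step3_add:
  assumes "y \<notin> \<int>" "y - \<epsilon> \<notin> \<int>" "y - l \<notin> \<int>"
  shows "\<forall>\<^sub>F e in at (0::real). step3 \<epsilon> l a b d (y + e) = step3 \<epsilon> l a b d y"
proof -
  have less: "\<forall>\<^sub>F e in at (0::real). frac y + e < t \<longleftrightarrow> frac y < t" if "y - t \<notin> \<int>" for t
  proof -
    have "frac y \<noteq> t"
      using that by (auto simp: frac_def)
    then consider "0 < t - frac y" | "t - frac y < 0"
      by linarith
    then show ?thesis
    proof cases
      case 1
      from order_tendstoD(2)[OF tendsto_ident_at this] show ?thesis
        by eventually_elim (use 1 in auto)
    next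
      case 2
      from order_tendstoD(1)[OF tendsto_ident_at this] show ?thesis
        by eventually_elim (use 2 in auto)
    qed
  qed
  show ?thesis
    using eventually_frac_add[OF assms(1)] less[OF assms(2)] less[OF assms(3)]
    by eventually_elim (simp add: step3_def)
qed

section \<open>Bounded sums along a rotation orbit\<close>

lemma sum_lessThan_add:
  fixes f :: "nat \<Rightarrow> 'a :: comm_monoid_add"
  shows "(\<Sum>i<m + n. f i) = (\<Sum>i<m. f i) + (\<Sum>k<n. f (m + k))"
  by (induction n) (auto simp: add.assoc)

text \<open>Take a stretch of the orbit whose increment \<open>v\<close> almost attains the supremum
  \<open>A\<close> of all differences. By right-continuity every orbit point slightly to the right
  of the start of the stretch has the same increment \<open>v\<close>. If two such points had sums
  differing by more than \<open>\<eta>\<close>, adding \<open>v\<close> to one of them would give a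
  difference above \<open>A\<close>.\<close>

lemma rotation_bounded_sums_small_oscillation:
  fixes F :: "real \<Rightarrow> real" and \<epsilon> z C \<eta> :: real
  defines "s \<equiv> \<lambda>n::nat. \<Sum>i<n. F (z - real i * \<epsilon>)"
  assumes periodic: "\<And>y h. F (y + of_int h) = F y"
    and right: "\<And>y. \<forall>\<^sub>F e in at_right 0. F (y + e) = F y"
    and bounded: "\<And>n. \<bar>s n\<bar> \<le> C"
    and "\<eta> > 0"
  obtains a b :: real where "a < b"
    and "\<And>i j g h. \<lbrakk>z - real i * \<epsilon> + of_int g \<in> {a<..<b}; z - real j * \<epsilon> + of_int h \<in> {a<..<b}\<rbrakk>
           \<Longrightarrow> \<bar>s i - s j\<bar> \<le> \<eta>"
proof -
  define y where "y n = z - real n * \<epsilon>" for n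
  have s_add: "s (i + n) = s i + (\<Sum>k<n. F (y i - real k * \<epsilon>))" for i n
    unfolding s_def y_def sum_lessThan_add by (simp add: algebra_simps)
  define A where "A = (SUP (i, j). s i - s j)"
  have bdd: "bdd_above (range (\<lambda>(i, j). s i - s j))"
  proof (rule bdd_aboveI2)
    show "(\<lambda>(i, j). s i - s j) p \<le> 2 * C" for p
      using bounded[of "fst p"] bounded[of "snd p"] by (auto simp: case_prod_beta)
  qed
  have le_A: "s i - s j \<le> A" for i j
    unfolding A_def using cSUP_upper[OF UNIV_I bdd, of "(i, j)"] by simp
  have "A - \<eta> < A"
    using \<open>\<eta> > 0\<close> by simp
  then obtain p q where pq: "A - \<eta> < s p - s q"
    unfolding A_def by (subst (asm) less_cSUP_iff[OF _ bdd]) auto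
  \<comment> \<open>The order of \<open>p\<close> and \<open>q\<close> is unknown, so the stretch
    runs from the smaller to the larger index and only the absolute value of its increment is
    controlled.\<close>
  define m where "m = min p q"
  define N where "N = max p q - min p q"
  define v where "v = s (m + N) - s m"
  have v: "A - \<eta> < \<bar>v\<bar>"
    using pq by (auto simp: v_def m_def N_def min_def max_def abs_if split: if_splits)
  have "\<forall>\<^sub>F e in at_right 0. \<forall>k\<in>{..<N}. F (y m - real k * \<epsilon> + e) = F (y m - real k * \<epsilon>)"
    by (intro eventually_ball_finite) (auto intro: right)
  then obtain \<gamma> where "\<gamma> > 0"
    and \<gamma>: "\<And>e k. \<lbrakk>0 < e; e < \<gamma>; k < N\<rbrakk> \<Longrightarrow> F (y m - real k * \<epsilon> + e) = F (y m - real k * \<epsilon>)"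
    unfolding eventually_at_right_field by auto
  have same: "s (i + N) = s i + v" if "y i + of_int h \<in> {y m<..<y m + \<gamma>}" for i h
  proof -
    have "F (y i - real k * \<epsilon>) = F (y m - real k * \<epsilon>)" if "k < N" for k
    proof -
      have "F (y i - real k * \<epsilon>) = F (y i - real k * \<epsilon> + of_int h)"
        by (simp only: periodic)
      also have "\<dots> = F (y m - real k * \<epsilon> + (y i + of_int h - y m))"
        by (simp add: algebra_simps)
      also have "\<dots> = F (y m - real k * \<epsilon>)"
        using \<open>y i + of_int h \<in> _\<close> that by (intro \<gamma>) auto
      finally show ?thesis .
    qed
    then show ?thesis
      by (simp add: s_add v_def)
  qed
  show thesis
  proof (rule that[of "y m" "y m + \<gamma>"])
    fix i j g h
    assume "z - real i * \<epsilon> + of_int g \<in> {y m<..<y m + \<gamma>}" "z - real j * \<epsilon> + of_int h \<in> {y m<..<y m + \<gamma>}"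
    then have "s (i + N) = s i + v" "s (j + N) = s j + v"
      using same by (auto simp: y_def)
    then show "\<bar>s i - s j\<bar> \<le> \<eta>"
      using v le_A[of "i + N" j] le_A[of i "j + N"] le_A[of "j + N" i] le_A[of j "i + N"] by linarith
  qed (use \<open>\<gamma> > 0\<close> in simp)
qed

lemma rotation_bounded_sums_no_jump:
  fixes \<epsilon> l a b d z C :: real
  assumes \<epsilon>: "0 < \<epsilon>" "\<epsilon> < l" "l < 1"
    and irrational: "\<epsilon> \<notin> \<rat>"
    and generic: "l \<notin> {of_int a + of_int b * \<epsilon> | a b. True}"
    and bounded: "\<And>n. \<bar>\<Sum>i<n. step3 \<epsilon> l a b d (z - real i * \<epsilon>)\<bar> \<le> C"
  shows "b = d"
proof (rule ccontr)
  assume "b \<noteq> d"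
  define F where "F = step3 \<epsilon> l a b d"
  define y where "y n = z - real n * \<epsilon>" for n
  define s where "s n = (\<Sum>i<n. F (z - real i * \<epsilon>))" for n :: nat
  have periodic: "F (y + of_int h) = F y" for y h
    by (simp add: F_def)
  have s_add: "s (i + n) = s i + (\<Sum>k<n. F (y i - real k * \<epsilon>))" for i n
    unfolding s_def y_def sum_lessThan_add by (simp add: algebra_simps)
  have pos: "\<bar>d - b\<bar> / 4 > 0"
    using \<open>b \<noteq> d\<close> by simp
  obtain p q where "p < q" and osc:
    "\<And>i j g h. \<lbrakk>y i + of_int g \<in> {p<..<q}; y j + of_int h \<in> {p<..<q}\<rbrakk> \<Longrightarrow> \<bar>s i - s j\<bar> \<le> \<bar>d - b\<bar> / 4"
    unfolding s_def y_def
    by (rule rotation_bounded_sums_small_oscillation[of F z \<epsilon> C "\<bar>d - b\<bar> / 4"])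
       (use bounded pos in \<open>auto simp: F_def eventually_step3_add_right\<close>)

  have irrational': "- \<epsilon> \<notin> \<rat>"
    using irrational by (simp add: Rats_minus_iff)
  obtain n h where "n \<ge> 1" and n: "l - real n * \<epsilon> + of_int h \<in> {p<..<q}"
    by (rule irrational_rotation_hits_interval[OF irrational' \<open>p < q\<close>, of 1 l]) auto
  obtain n' h' where n': "l + real n' * \<epsilon> + of_int h' \<in> {p<..<q}"
    by (rule irrational_rotation_hits_interval[OF irrational \<open>p < q\<close>, of 1 l]) auto

  \<comment> \<open>The orbit of \<open>l\<close> itself, indexed so that \<open>x n' = l\<close>.
    Modulo 1, \<open>x 0\<close> and \<open>x (n' + n)\<close> lie in the interval of small
    oscillation.\<close>
  define x where "x k = l - (real k - real n') * \<epsilon>" for k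
  have notint: "l - of_int k * \<epsilon> \<notin> \<int>" for k
  proof
    assume "l - of_int k * \<epsilon> \<in> \<int>"
    then obtain m where "l - of_int k * \<epsilon> = of_int m"
      by (auto elim: Ints_cases)
    then have "l = of_int m + of_int k * \<epsilon>"
      by simp
    then show False
      using generic by blast
  qed
  have notint': "of_int k * \<epsilon> \<notin> \<int>" if "k \<noteq> 0" for k
  proof
    assume "of_int k * \<epsilon> \<in> \<int>"
    then have "of_int k * \<epsilon> \<in> \<rat>"
      using Ints_subset_Rats by blast
    then have "of_int k * \<epsilon> / of_int k \<in> \<rat>"
      by (intro Rats_divide) auto
    then show False
      using that irrational by simp
  qed
  \<comment> \<open>Genericity of \<open>l\<close> keeps its orbit away from 0 and
    \<open>\<epsilon>\<close>. Irrationality keeps it from meeting \<open>l\<close> again, so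
    \<open>n'\<close> is the only exceptional index.\<close>
  have cont: "\<forall>\<^sub>F e in at 0. F (x k + e) = F (x k)" if "k \<noteq> n'" for k
    unfolding F_def
  proof (rule eventually_step3_add)
    show "x k \<notin> \<int>" "x k - \<epsilon> \<notin> \<int>"
      using notint[of "int k - int n'"] notint[of "int k - int n' + 1"] by (auto simp: x_def algebra_simps)
    have "x k - l = of_int (int n' - int k) * \<epsilon>"
      by (simp add: x_def algebra_simps)
    then show "x k - l \<notin> \<int>"
      using notint'[of "int n' - int k"] that by simp
  qed
  have near: "\<forall>\<^sub>F e in at 0. w + e \<in> {p<..<q}" if "w \<in> {p<..<q}" for w
  proof -
    have "\<forall>\<^sub>F e in at (0::real). p - w < e \<and> e < q - w"
      using that by (auto intro!: eventually_conj order_tendstoD[OF tendsto_ident_at])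
    then show ?thesis
      by eventually_elim auto
  qed
  have jump: "\<forall>\<^sub>F e in at 0. F (l + e) = (if e < 0 then b else d)"
  proof -
    have "\<forall>\<^sub>F e in at (0::real). \<epsilon> - l < e \<and> e < 1 - l"
      using \<epsilon> by (auto intro!: eventually_conj order_tendstoD[OF tendsto_ident_at])
    then show ?thesis
    proof eventually_elim
      case (elim e)
      then have "frac (l + e) = l + e"
        using \<epsilon> by (simp add: frac_eq)
      then show ?case
        using elim by (simp add: F_def step3_def)
    qed
  qed
  have "\<forall>\<^sub>F e in at 0. \<forall>k\<in>{..<n' + n} - {n'}. F (x k + e) = F (x k)"
    by (intro eventually_ball_finite) (auto intro: cont)
  with near[OF n] near[OF n'] jump
  have "\<forall>\<^sub>F e in at 0. (\<forall>k\<in>{..<n' + n} - {n'}. F (x k + e) = F (x k)) \<and>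
      F (l + e) = (if e < 0 then b else d) \<and>
      l - real n * \<epsilon> + of_int h + e \<in> {p<..<q} \<and> l + real n' * \<epsilon> + of_int h' + e \<in> {p<..<q}"
    by eventually_elim auto
  then obtain \<gamma> where "\<gamma> > 0" and
    \<gamma>: "\<And>e. \<lbrakk>e \<noteq> 0; \<bar>e\<bar> < \<gamma>\<rbrakk> \<Longrightarrow> (\<forall>k\<in>{..<n' + n} - {n'}. F (x k + e) = F (x k)) \<and>
      F (l + e) = (if e < 0 then b else d) \<and>
      l - real n * \<epsilon> + of_int h + e \<in> {p<..<q} \<and> l + real n' * \<epsilon> + of_int h' + e \<in> {p<..<q}"
    unfolding eventually_at by (auto simp: dist_real_def)

  define S where "S = (\<Sum>k\<in>{..<n' + n} - {n'}. F (x k))"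
  \<comment> \<open>Density gives an orbit point \<open>l + e\<close> modulo 1 with \<open>e\<close>
    between \<open>e1\<close> and \<open>e2\<close>. The last condition keeps this range on one side
    of 0, so the sign of \<open>e1\<close> decides which of \<open>b\<close>, \<open>d\<close> is
    picked up at \<open>l\<close>. Asking for \<open>j \<ge> n'\<close> leaves room to go back
    \<open>n'\<close> steps.\<close>
  have visit: "\<exists>i g h. y i + of_int g \<in> {p<..<q} \<and> y (i + (n' + n)) + of_int h \<in> {p<..<q} \<and>
      s (i + (n' + n)) = s i + S + (if e1 < 0 then b else d)"
    if e: "e1 < e2" "- \<gamma> < e1" "e2 < \<gamma>" "e1 < 0 \<longleftrightarrow> e2 \<le> 0" for e1 e2
  proof -
    obtain j g where "j \<ge> n'" and j: "l + e1 < y j + of_int g" "y j + of_int g < l + e2"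
      by (rule irrational_rotation_hits_interval[of "- \<epsilon>" "l + e1" "l + e2" n' z])
         (use irrational' e(1) in \<open>auto simp: y_def\<close>)
    define e where "e = y j + of_int g - l"
    define i where "i = j - n'"
    have "e \<noteq> 0" "\<bar>e\<bar> < \<gamma>" and sign: "e < 0 \<longleftrightarrow> e1 < 0"
      using j e by (auto simp: e_def)
    note \<gamma> = \<gamma>[OF this(1,2)]
    have yi: "y i = l + real n' * \<epsilon> + e - of_int g"
      using \<open>j \<ge> n'\<close> by (simp add: e_def i_def y_def of_nat_diff algebra_simps)
    have translate: "F (y i - real k * \<epsilon>) = F (x k + e)" for k
    proof -
      have "y i - real k * \<epsilon> = x k + e + of_int (- g)"
        by (simp add: yi x_def algebra_simps)
      then show ?thesis
        by (simp only: periodic)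
    qed
    have "(\<Sum>k<n' + n. F (y i - real k * \<epsilon>)) = (\<Sum>k<n' + n. F (x k + e))"
      by (simp add: translate)
    also have "\<dots> = F (x n' + e) + (\<Sum>k\<in>{..<n' + n} - {n'}. F (x k + e))"
      using \<open>n \<ge> 1\<close> by (intro sum.remove) auto
    also have "(\<Sum>k\<in>{..<n' + n} - {n'}. F (x k + e)) = S"
      unfolding S_def by (intro sum.cong) (use \<gamma> in auto)
    also have "F (x n' + e) = (if e1 < 0 then b else d)"
      using \<gamma> sign by (simp add: x_def)
    finally have "s (i + (n' + n)) = s i + S + (if e1 < 0 then b else d)"
      by (simp add: s_add)
    moreover have "y i + of_int (g + h') \<in> {p<..<q}"
      using \<gamma> by (simp add: yi algebra_simps)
    moreover have "y (i + (n' + n)) = y i - real n' * \<epsilon> - real n * \<epsilon>"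
      by (simp add: y_def algebra_simps)
    then have "y (i + (n' + n)) + of_int (g + h) \<in> {p<..<q}"
      using \<gamma> by (simp add: yi algebra_simps)
    ultimately show ?thesis
      by blast
  qed
  obtain i g h where i: "y i + of_int g \<in> {p<..<q}" "y (i + (n' + n)) + of_int h \<in> {p<..<q}"
      "s (i + (n' + n)) = s i + S + b"
    using visit[of "- \<gamma> / 2" 0] \<open>\<gamma> > 0\<close> by auto
  obtain j g' h' where j: "y j + of_int g' \<in> {p<..<q}" "y (j + (n' + n)) + of_int h' \<in> {p<..<q}"
      "s (j + (n' + n)) = s j + S + d"
    using visit[of 0 "\<gamma> / 2"] \<open>\<gamma> > 0\<close> by auto
  \<comment> \<open>The common part \<open>S\<close> cancels, and each of the two ends contributes
    at most a quarter of the jump.\<close>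
  have "\<bar>d - b\<bar> \<le> \<bar>s i - s j\<bar> + \<bar>s (i + (n' + n)) - s (j + (n' + n))\<bar>"
    using i(3) j(3) by linarith
  also have "\<dots> \<le> \<bar>d - b\<bar> / 4 + \<bar>d - b\<bar> / 4"
    by (intro add_mono osc[OF i(1) j(1)] osc[OF i(2) j(2)])
  finally show False
    using pos by simp
qed

section \<open>Substitutions and letter weights\<close>

lemma flat_sdrop:
  assumes "\<forall>w\<in>sset s. w \<noteq> []"
  shows "flat s = concat (stake n s) @- flat (sdrop n s)"
  using assms
proof (induction n arbitrary: s)
  case (Suc n)
  have "flat s = shd s @- flat (stl s)"
    using Suc.prems by (intro flat_unfold) (auto simp: shd_sset)
  also have "flat (stl s) = concat (stake n (stl s)) @- flat (sdrop n (stl s))"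
    using Suc.prems by (intro Suc.IH) (auto intro: stl_sset)
  finally show ?case
    by simp
qed simp

text \<open>This is what the argument uses of the fixed point equation. Being about finite words, it
  passes to iterates directly.\<close>

definition preserves_prefixes :: "(letter list \<Rightarrow> letter list) \<Rightarrow> letter stream \<Rightarrow> bool" where
  "preserves_prefixes \<phi> u \<longleftrightarrow> (\<forall>n. \<exists>m. \<phi> (stake n u) = stake m u)"

lemma substitution_eq_concat:
  assumes "substitution \<phi>"
  shows "\<phi> w = concat (map (\<lambda>a. \<phi> [a]) w)"
proof (induction w)
  case (Cons a w)
  have "\<phi> (a # w) = \<phi> [a] @ \<phi> w"
    using assms unfolding substitution_def by (metis append_Cons append_Nil)
  then show ?case
    using Cons by simp
qed (use assms in \<open>simp add: substitution_def\<close>)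

lemma fixed_point_preserves_prefixes:
  assumes "substitution \<phi>" "subst_stream \<phi> u = u"
  shows "preserves_prefixes \<phi> u"
  unfolding preserves_prefixes_def
proof
  fix n
  have "u = flat (smap (\<lambda>a. \<phi> [a]) u)"
    using assms(2) by (simp add: subst_stream_def)
  also have "\<dots> = concat (stake n (smap (\<lambda>a. \<phi> [a]) u)) @- flat (sdrop n (smap (\<lambda>a. \<phi> [a]) u))"
    by (rule flat_sdrop) (use assms(1) in \<open>auto simp: substitution_def stream.set_map\<close>)
  also have "concat (stake n (smap (\<lambda>a. \<phi> [a]) u)) = \<phi> (stake n u)"
    by (simp add: substitution_eq_concat[OF assms(1), of "stake n u"])
  finally obtain v where "u = \<phi> (stake n u) @- v" ..
  then have "stake (length (\<phi> (stake n u))) (\<phi> (stake n u) @- v) = stake (length (\<phi> (stake n u))) u"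
    by simp
  then show "\<exists>m. \<phi> (stake n u) = stake m u"
    by (auto simp: stake_shift)
qed

lemma preserves_prefixes_funpow:
  assumes "preserves_prefixes \<phi> u"
  shows "preserves_prefixes (\<phi> ^^ k) u"
  using assms by (induction k) (auto simp: preserves_prefixes_def, metis)

lemma substitution_funpow:
  assumes "substitution \<phi>"
  shows "substitution (\<phi> ^^ k)"
proof -
  have nonempty: "\<phi> w \<noteq> []" if "w \<noteq> []" for w
    using that assms substitution_eq_concat[OF assms, of w] by (cases w) (auto simp: substitution_def)
  have "(\<phi> ^^ k) [] = []" "(\<phi> ^^ k) (v @ w) = (\<phi> ^^ k) v @ (\<phi> ^^ k) w"
      "v \<noteq> [] \<Longrightarrow> (\<phi> ^^ k) v \<noteq> []" for v w
    using assms nonempty by (induction k) (auto simp: substitution_def)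
  then show ?thesis
    by (auto simp: substitution_def)
qed

section \<open>Letter weights and incidence matrices\<close>

definition weight :: "('b \<Rightarrow> 'a :: comm_monoid_add) \<Rightarrow> 'b list \<Rightarrow> 'a" where
  "weight v w = sum_list (map v w)"

lemma weight_simps [simp]:
  "weight v [] = 0"
  "weight v (a # w) = v a + weight v w"
  "weight v (w @ w') = weight v w + weight v w'"
  by (simp_all add: weight_def)

text \<open>The weight vector on the right is the incidence matrix applied to
  \<open>v\<close>.\<close>

lemma weight_substitution:
  assumes "substitution \<phi>"
  shows "weight v (\<phi> w) = weight (\<lambda>a. weight v (\<phi> [a])) w"
proof (induction w)
  case (Cons a w)
  have "\<phi> (a # w) = \<phi> [a] @ \<phi> w"
    using assms unfolding substitution_def by (metis append_Cons append_Nil)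
  then show ?case
    using Cons by simp
qed (use assms in \<open>simp add: substitution_def\<close>)

lemma weight_linear:
  fixes v w :: "'b \<Rightarrow> real"
  shows "weight (\<lambda>a. r * v a + s * w a) x = r * weight v x + s * weight w x"
  by (induction x) (auto simp: algebra_simps)

lemma weight_eigenvector:
  fixes v :: "letter \<Rightarrow> real"
  assumes "substitution \<phi>" "\<And>a. weight v (\<phi> [a]) = r * v a"
  shows "weight v ((\<phi> ^^ k) [a]) = r ^ k * v a"
proof (induction k)
  case (Suc k)
  \<comment> \<open>The zero summand only brings the function into the shape required by
    \<open>weight_linear\<close>.\<close>
  have "weight v ((\<phi> ^^ Suc k) [a]) = weight (\<lambda>a. r * v a + 0 * v a) ((\<phi> ^^ k) [a])"
    using assms(2) by (simp add: weight_substitution[OF assms(1), of v "(\<phi> ^^ k) [a]"])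
  then show ?case
    unfolding weight_linear using Suc by simp
qed simp

lemma count_list_substitution:
  assumes "substitution \<phi>"
  shows "count_list (\<phi> w) b = (\<Sum>a\<in>UNIV. count_list w a * count_list (\<phi> [a]) b)"
proof (induction w)
  case (Cons a w)
  have "\<phi> (a # w) = \<phi> [a] @ \<phi> w"
    using assms unfolding substitution_def by (metis append_Cons append_Nil)
  then show ?case
    using Cons by (cases a) (simp_all add: UNIV_letter)
qed (use assms in \<open>simp add: substitution_def\<close>)

text \<open>Both sides satisfy the same recursion once the innermost \<open>\<phi>\<close> is split
  off, since powers multiply by the matrix on the left.\<close>

lemma matrix_power_incidence_matrix:
  assumes "substitution \<phi>"
  shows "matrix_power (incidence_matrix \<phi>) k $ i $ j = count_list ((\<phi> ^^ k) [i]) j"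
proof (induction k arbitrary: i)
  case 0
  show ?case
    by (auto simp: matrix_power_def mat_def)
next
  case (Suc k)
  have "matrix_power (incidence_matrix \<phi>) (Suc k) $ i $ j =
      (\<Sum>a\<in>UNIV. count_list (\<phi> [i]) a * matrix_power (incidence_matrix \<phi>) k $ a $ j)"
    by (simp add: matrix_power_def matrix_matrix_mult_def incidence_matrix_def)
  also have "\<dots> = count_list ((\<phi> ^^ k) (\<phi> [i])) j"
    unfolding Suc by (rule count_list_substitution[symmetric, OF substitution_funpow[OF assms]])
  finally show ?case
    by (simp add: funpow_swap1)
qed

lemma primitive_substitutionE:
  assumes "primitive_substitution \<phi>"
  obtains k where "\<And>i j. j \<in> set ((\<phi> ^^ k) [i])"
proof -
  obtain k where k: "\<And>i j. matrix_power (incidence_matrix \<phi>) k $ i $ j > 0"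
    and "substitution \<phi>"
    using assms by (auto simp: primitive_substitution_def)
  then have "count_list ((\<phi> ^^ k) [i]) j > 0" for i j
    using matrix_power_incidence_matrix by metis
  then show thesis
    using that[of k] by (metis count_list_0_iff less_irrefl)
qed

section \<open>Conjugates from an integral quadratic equation\<close>

lemma quadratic_conjugates_of_int:
  fixes x :: real and a b c :: int
  assumes "a \<noteq> 0" and root: "of_int a * x\<^sup>2 + of_int b * x + of_int c = 0" and "x \<notin> \<rat>"
  shows "quadratic_conjugates x (- of_int b / of_int a - x)"
proof -
  define x' where "x' = - of_int b / of_int a - x"
  define p :: "rat poly" where "p = [:of_int c, of_int b, of_int a:]"
  have rat: "- of_int b / of_int a \<in> (\<rat> :: real set)"
    by (intro Rats_divide) auto
  have "x' \<notin> \<rat>"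
  proof
    assume "x' \<in> \<rat>"
    with rat have "- of_int b / of_int a - x' \<in> \<rat>"
      by (rule Rats_diff)
    then show False
      using \<open>x \<notin> \<rat>\<close> by (simp add: x'_def)
  qed
  have "x \<noteq> x'"
  proof
    assume "x = x'"
    then have "x = (- of_int b / of_int a) / 2"
      by (simp add: x'_def)
    then have "x \<in> \<rat>"
      using rat Rats_divide[of _ 2] by auto
    then show False
      using \<open>x \<notin> \<rat>\<close> by contradiction
  qed
  have eval: "poly (map_poly of_rat p) y = of_int a * y\<^sup>2 + of_int b * y + of_int c" for y :: real
    by (simp add: p_def map_poly_pCons power2_eq_square algebra_simps)
  have "of_int a * x' = - of_int b - of_int a * x"
    using \<open>a \<noteq> 0\<close> by (simp add: x'_def field_simps)
  then have "of_int a * (of_int a * x'\<^sup>2 + of_int b * x' + of_int c) =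
      of_int a * (of_int a * x\<^sup>2 + of_int b * x + of_int c)"
    by algebra
  then have root': "of_int a * x'\<^sup>2 + of_int b * x' + of_int c = 0"
    using root \<open>a \<noteq> 0\<close> by simp
  have factor: "of_int a * ((y - x) * (y - x')) = of_int a * y\<^sup>2 + of_int b * y + of_int c" for y
    using root \<open>of_int a * x' = _\<close> by algebra
  have roots: "y = x \<or> y = x'" if "poly (map_poly of_rat p) y = 0" for y
  proof -
    have "of_int a * ((y - x) * (y - x')) = 0"
      using that unfolding eval by (simp only: factor)
    then show ?thesis
      using \<open>a \<noteq> 0\<close> by simp
  qed
  have deg: "degree p = 2"
    using \<open>a \<noteq> 0\<close> by (simp add: p_def)
  \<comment> \<open>A linear factor would yield a rational root, but the only real roots are the
    irrational \<open>x\<close> and \<open>x'\<close>.\<close>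
  have no_linear_factor: "degree q \<noteq> 1" if "q dvd p" for q
  proof
    assume "degree q = 1"
    then obtain q0 q1 where q: "q = [:q0, q1:]" "q1 \<noteq> 0"
      by (rule degree1_coeffs)
    then have "poly q (- q0 / q1) = 0"
      by simp
    then have "poly p (- q0 / q1) = 0"
      using \<open>q dvd p\<close> by auto
    moreover have "poly (map_poly of_rat p) (of_rat t) = (of_rat (poly p t) :: real)" for t
      by (simp add: p_def map_poly_pCons of_rat_add of_rat_mult)
    ultimately have "poly (map_poly of_rat p) (of_rat (- q0 / q1) :: real) = 0"
      by simp
    then show False
      using roots \<open>x \<notin> \<rat>\<close> \<open>x' \<notin> \<rat>\<close> by (metis Rats_of_rat)
  qed
  have "irreducible p"
  proof (rule irreducibleI)
    fix q r assume "p = q * r"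
    then have "q \<noteq> 0" "r \<noteq> 0" "q dvd p" "r dvd p"
      using deg by auto
    moreover from this have "degree q + degree r = 2"
      using deg \<open>p = q * r\<close> by (simp add: degree_mult_eq)
    ultimately have "degree q = 0 \<or> degree r = 0"
      using no_linear_factor[of q] no_linear_factor[of r] by linarith
    then show "is_unit q \<or> is_unit r"
      using \<open>q \<noteq> 0\<close> \<open>r \<noteq> 0\<close> by (simp add: is_unit_iff_degree)
  qed (use deg in \<open>auto simp: is_unit_poly_iff\<close>)
  then show ?thesis
    using \<open>x \<noteq> x'\<close> deg root root' unfolding quadratic_conjugates_def x'_def[symmetric]
    by (intro conjI exI[of _ p]) (simp_all add: eval)
qed

section \<open>Three interval exchange words\<close>

text \<open>On the circle of length 1, the letters \<open>LA\<close> and \<open>LC\<close> stand for one step of the rotation by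
  \<open>- \<epsilon>\<close> and \<open>LB\<close> for two; \<open>wraps\<close> counts how often it passes the point \<open>c\<close>.\<close>

fun steps :: "letter \<Rightarrow> nat" where
  "steps LA = 1" | "steps LB = 2" | "steps LC = 1"

fun wraps :: "letter \<Rightarrow> nat" where
  "wraps LA = 1" | "wraps LB = 1" | "wraps LC = 0"

text \<open>The translation vector \<open>t\<close> of the exchange. The parameter is kept explicit
  because the conjugate of \<open>\<epsilon>\<close> is inserted later.\<close>

definition displacement :: "real \<Rightarrow> letter \<Rightarrow> real" where
  "displacement \<epsilon> X = real (wraps X) - \<epsilon> * real (steps X)"

lemma displacement_simps [simp]:
  "displacement \<epsilon> LA = 1 - \<epsilon>"
  "displacement \<epsilon> LB = 1 - 2 * \<epsilon>"
  "displacement \<epsilon> LC = - \<epsilon>"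
  by (simp_all add: displacement_def)

lemma weight_displacement:
  "weight (displacement \<epsilon>) w = real (weight wraps w) - \<epsilon> * real (weight steps w)"
  by (induction w) (auto simp: displacement_def algebra_simps)

lemma length_le_weight_steps: "length w \<le> weight steps w"
proof (induction w)
  case (Cons X w)
  then show ?case
    by (cases X) auto
qed simp

lemma irrational_coeff_zero:
  fixes \<epsilon> :: real and a b :: int
  assumes "\<epsilon> \<notin> \<rat>" "of_int a + of_int b * \<epsilon> = 0"
  shows "a = 0 \<and> b = 0"
proof -
  have "b = 0"
  proof (rule ccontr)
    assume "b \<noteq> 0"
    then have "\<epsilon> = - of_int a / of_int b"
      using assms(2) by (simp add: field_simps)
    then show False
      using assms(1) by (metis Rats_divide Rats_minus_iff Rats_of_int)
  qed
  then show ?thesis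
    using assms(2) by simp
qed

locale nondegenerate_3iet_word =
  fixes \<epsilon> l c :: real and u :: "letter stream"
  assumes \<epsilon>: "0 < \<epsilon>" "\<epsilon> < 1"
    and l: "max \<epsilon> (1 - \<epsilon>) < l" "l < 1"
    and c: "- l < c" "c \<le> 0"
    and irrational: "\<epsilon> \<notin> \<rat>"
    and generic: "l \<notin> {of_int a + of_int b * \<epsilon> | a b. True}"
    and word: "is_3iet_word \<epsilon> l c u"
begin

section \<open>The orbit of 0 as a sampled rotation orbit\<close>

definition orbit :: "nat \<Rightarrow> real" where
  "orbit n = weight (displacement \<epsilon>) (stake n u)"

lemma orbit_interval: "orbit n \<in> iet_interval \<epsilon> l c (u !! n)"
proof -
  have in_interval: "(iet_map \<epsilon> l c ^^ n) 0 \<in> iet_interval \<epsilon> l c (u !! n)" for n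
    using word by (auto simp: is_3iet_word_def)
  have "(iet_map \<epsilon> l c ^^ n) 0 = orbit n"
  proof (induction n)
    case (Suc n)
    \<comment> \<open>The point lies in one of the three intervals, so the \<open>undefined\<close>
      branch is never reached.\<close>
    have "iet_map \<epsilon> l c (orbit n) = orbit n + displacement \<epsilon> (u !! n)"
      using in_interval[of n] l unfolding Suc by (cases "u !! n") (auto simp: iet_map_def)
    then show ?case
      by (simp add: Suc) (simp add: orbit_def stake_Suc del: stake.simps(2))
  qed (simp add: orbit_def)
  then show ?thesis
    using in_interval[of n] by simp
qed

lemma orbit_bounds: "c \<le> orbit n" "orbit n < c + l"
  using orbit_interval[of n] l by (cases "u !! n"; auto)+

definition time :: "nat \<Rightarrow> nat" where
  "time n = weight steps (stake n u)"

lemma time_Suc: "time (Suc n) = time n + steps (u !! n)"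
  by (simp add: time_def stake_Suc del: stake.simps(2))

lemma time_cover: "\<exists>n. m = time n \<or> m = Suc (time n)"
proof (induction m)
  case 0
  have "time 0 = 0"
    by (simp add: time_def)
  then show ?case
    by metis
next
  case (Suc m)
  then obtain n where "m = time n \<or> m = Suc (time n)"
    by blast
  moreover have "time (Suc n) = Suc (time n) \<or> time (Suc n) = Suc (Suc (time n))"
    by (cases "u !! n") (auto simp: time_Suc)
  ultimately show ?case
    by metis
qed

text \<open>Modulo 1 the orbit point is \<open>- time n * \<epsilon>\<close>, the difference being
  the number of wraps. Here \<open>r\<close> is a further rotation and \<open>h\<close> the integer
  that brings the result into the unit interval.\<close>

lemma frac_rotation:
  assumes "0 \<le> orbit n - c - r + of_int h" "orbit n - c - r + of_int h < 1"
  shows "frac (- c - real (time n) * \<epsilon> - r) = orbit n - c - r + of_int h"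
proof -
  have "- c - real (time n) * \<epsilon> - r - (orbit n - c - r + of_int h) =
      of_int (- int (weight wraps (stake n u)) - h)"
    by (simp add: orbit_def time_def weight_displacement)
  then have "- c - real (time n) * \<epsilon> - r - (orbit n - c - r + of_int h) \<in> \<int>"
    by (metis Ints_of_int)
  then show ?thesis
    using assms unfolding frac_unique_iff by blast
qed

text \<open>Measured from \<open>c\<close>, the exchange is the first return to
  \<open>[0, l)\<close> of the rotation by \<open>- \<epsilon>\<close>. A letter \<open>LB\<close>
  makes a detour through \<open>[l, 1)\<close>: its first step starts below
  \<open>\<epsilon>\<close> and is charged \<open>v LA\<close> as for \<open>LA\<close>, and its
  second step pays the rest, \<open>v LB - v LA\<close>.\<close>

lemma weight_eq_rotation_sum:
  fixes v :: "letter \<Rightarrow> real"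
  shows
  "weight v (stake n u) =
     (\<Sum>i<time n. step3 \<epsilon> l (v LA) (v LC) (v LB - v LA) (- c - real i * \<epsilon>))"
proof (induction n)
  case 0
  show ?case
    by (simp add: time_def)
next
  case (Suc n)
  have frac1: "frac (- c - real (time n) * \<epsilon>) = orbit n - c"
    using frac_rotation[of n 0 0] orbit_bounds[of n] l by simp
  show ?case
  proof (cases "u !! n")
    case LB
    have "orbit n \<in> {c + \<epsilon> + l - 1 ..< c + \<epsilon>}"
      using orbit_interval[of n] LB by simp
    moreover have shift: "- c - real (Suc (time n)) * \<epsilon> = - c - real (time n) * \<epsilon> - \<epsilon>"
      by (simp add: algebra_simps)
    moreover from calculation have "frac (- c - real (Suc (time n)) * \<epsilon>) = orbit n - c - \<epsilon> + 1"
      unfolding shift using frac_rotation[of n \<epsilon> 1] l \<epsilon> by simp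
    ultimately show ?thesis
      using l LB frac1
      by (simp add: stake_Suc time_Suc Suc step3_def numeral_2_eq_2 del: stake.simps(2) of_nat_Suc)
  qed (use orbit_interval[of n] l frac1 in
        \<open>auto simp: stake_Suc time_Suc Suc step3_def simp del: stake.simps(2)\<close>)
qed

section \<open>Weights with bounded prefix sums\<close>

lemma bounded_weight_imp_additive:
  fixes v :: "letter \<Rightarrow> real"
  assumes bounded: "\<And>n. \<bar>weight v (stake n u)\<bar> \<le> C"
  shows "v LB = v LA + v LC"
proof -
  define F where "F = step3 \<epsilon> l (v LA) (v LC) (v LB - v LA)"
  \<comment> \<open>Prefix weights control the rotation sums only at the times
    \<open>time n\<close>. Any other time is one step later and costs at most
    \<open>D\<close>.\<close>
  define D where "D = \<bar>v LA\<bar> + \<bar>v LC\<bar> + \<bar>v LB - v LA\<bar>"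
  have F: "\<bar>F y\<bar> \<le> D" for y
    by (simp add: F_def D_def step3_def)
  have "\<bar>\<Sum>i<m. F (- c - real i * \<epsilon>)\<bar> \<le> C + D" for m
  proof -
    obtain n where "m = time n \<or> m = Suc (time n)"
      using time_cover by blast
    then show ?thesis
      using bounded[of n] F[of "- c - real (time n) * \<epsilon>"] weight_eq_rotation_sum[of v n]
      by (auto simp: F_def[symmetric])
  qed
  then have "v LC = v LB - v LA"
    using rotation_bounded_sums_no_jump[of \<epsilon> l "v LA" "v LC" "v LB - v LA" "- c" "C + D"]
      \<epsilon> l irrational generic by (simp add: F_def)
  then show ?thesis
    by simp
qed

text \<open>By additivity \<open>v\<close> is a combination of \<open>displacement\<close> and
  \<open>steps\<close>, with coefficients \<open>r\<close> and \<open>z\<close>. The prefix weights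
  of \<open>steps\<close> are unbounded while those of \<open>v\<close> and
  \<open>displacement\<close> are bounded, so \<open>z = 0\<close>.\<close>

lemma bounded_weight_imp_multiple:
  fixes v :: "letter \<Rightarrow> real"
  assumes bounded: "\<And>n. \<bar>weight v (stake n u)\<bar> \<le> C"
  shows "v X = (v LA - v LC) * displacement \<epsilon> X"
proof -
  define r where "r = v LA - v LC"
  define z where "z = v LC + r * \<epsilon>"
  have additive: "v LB = v LA + v LC"
    using bounded by (rule bounded_weight_imp_additive)
  have eq: "1 * v X + (- r) * displacement \<epsilon> X = z * real (steps X)" for X
    by (cases X) (auto simp: additive r_def z_def algebra_simps)
  have "z = 0"
  proof (rule ccontr)
    assume "z \<noteq> 0"
    have orbit: "\<bar>orbit n\<bar> \<le> 1" for n
      using orbit_bounds[of n] c l by linarith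
    obtain n :: nat where n: "(C + \<bar>r\<bar>) / \<bar>z\<bar> < n"
      using reals_Archimedean2 by blast
    have "z * real (weight steps w) = weight (\<lambda>X. z * real (steps X)) w" for w
      by (induction w) (auto simp: algebra_simps)
    then have "z * real (time n) = 1 * weight v (stake n u) + (- r) * orbit n"
      unfolding time_def orbit_def weight_linear[symmetric] eq .
    then have "\<bar>z * real (time n)\<bar> = \<bar>weight v (stake n u) - r * orbit n\<bar>"
      by simp
    then have "\<bar>z\<bar> * real (time n) \<le> \<bar>weight v (stake n u)\<bar> + \<bar>r\<bar> * \<bar>orbit n\<bar>"
      using abs_triangle_ineq4[of "weight v (stake n u)" "r * orbit n"] by (simp add: abs_mult)
    also have "\<dots> \<le> C + \<bar>r\<bar> * 1"
      by (intro add_mono bounded mult_left_mono orbit) auto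
    finally have "real (time n) \<le> (C + \<bar>r\<bar>) / \<bar>z\<bar>"
      using \<open>z \<noteq> 0\<close> by (simp add: field_simps)
    moreover have "n \<le> time n"
      using length_le_weight_steps[of "stake n u"] by (simp add: time_def)
    ultimately show False
      using n by linarith
  qed
  then show ?thesis
    using eq[of X] by (simp add: r_def algebra_simps)
qed

section \<open>Images of letters and the conjugate of \<open>\<epsilon>\<close>\<close>

lemma letter_image_displacement:
  assumes "substitution \<phi>" "preserves_prefixes \<phi> u" "u !! n = X"
  shows "\<bar>weight (displacement \<epsilon>) (\<phi> [X])\<bar> < 1"
proof -
  obtain i j where ij: "\<phi> (stake n u) = stake i u" "\<phi> (stake (Suc n) u) = stake j u"
    using assms(2) unfolding preserves_prefixes_def by metis
  have "\<phi> (stake (Suc n) u) = \<phi> (stake n u) @ \<phi> [X]"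
    using assms(1,3) by (simp add: substitution_def stake_Suc del: stake.simps(2))
  then have "orbit j = orbit i + weight (displacement \<epsilon>) (\<phi> [X])"
    unfolding orbit_def ij[symmetric] by simp
  then show ?thesis
    using orbit_bounds[of i] orbit_bounds[of j] l by linarith
qed

lemma positive_substitution_imp_sturm_number:
  assumes \<psi>: "substitution \<psi>" "preserves_prefixes \<psi> u"
    and positive: "\<And>i j. j \<in> set (\<psi> [i])"
  shows "sturm_number \<epsilon>"
proof -
  define W where "W X = int (weight wraps (\<psi> [X]))" for X
  define S where "S X = int (weight steps (\<psi> [X]))" for X
  define p where "p = W LA - W LC"
  define q where "q = S LC - S LA"
  have image: "weight (displacement e) (\<psi> [X]) = of_int (W X) - e * of_int (S X)" for e X
    by (simp add: W_def S_def weight_displacement)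
  have "\<bar>weight (\<lambda>X. weight (displacement \<epsilon>) (\<psi> [X])) (stake n u)\<bar> \<le> 1" for n
  proof -
    obtain m where m: "\<psi> (stake n u) = stake m u"
      using \<psi>(2) unfolding preserves_prefixes_def by metis
    have "weight (\<lambda>X. weight (displacement \<epsilon>) (\<psi> [X])) (stake n u) = orbit m"
      by (simp add: weight_substitution[OF \<psi>(1), of _ "stake n u", symmetric] m orbit_def)
    then show ?thesis
      using orbit_bounds[of m] c l by linarith
  qed
  from bounded_weight_imp_multiple[OF this]
  \<comment> \<open>The eigenvalue is the difference of the \<open>LA\<close> and \<open>LC\<close>
    entries of the image vector, which is \<open>p + q * \<epsilon>\<close>.\<close>
  have eigen: "weight (displacement \<epsilon>) (\<psi> [X]) = (of_int p + of_int q * \<epsilon>) * displacement \<epsilon> X" for X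
    by (simp add: image p_def q_def algebra_simps)

  \<comment> \<open>The displacement of \<open>LB\<close> is the sum of the other two. Comparing the
    coefficients of 1 and \<open>\<epsilon>\<close> gives integer identities, which remain usable
    for the conjugate.\<close>
  have WB: "W LB = W LA + W LC" and SB: "S LB = S LA + S LC"
  proof -
    have "of_int (W LB - W LA - W LC) + of_int (S LA + S LC - S LB) * \<epsilon> = 0"
      using eigen[of LA] eigen[of LB] eigen[of LC] by (simp add: image algebra_simps)
    from irrational_coeff_zero[OF irrational this]
    show "W LB = W LA + W LC" "S LB = S LA + S LC"
      by auto
  qed
  have root: "of_int q * \<epsilon>\<^sup>2 + of_int (p - S LC) * \<epsilon> + of_int (W LC) = 0"
    using eigen[of LC] by (simp add: image power2_eq_square algebra_simps)
  have "weight wraps w > 0" if "LA \<in> set w" for w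
    using that by (induction w) auto
  then have "W LC > 0"
    using positive by (simp add: W_def)
  have "q \<noteq> 0"
  proof
    assume "q = 0"
    then have "of_int (W LC) + of_int (p - S LC) * \<epsilon> = 0"
      using root by simp
    from irrational_coeff_zero[OF irrational this] show False
      using \<open>W LC > 0\<close> by simp
  qed
  define \<epsilon>' where "\<epsilon>' = - of_int (p - S LC) / of_int q - \<epsilon>"
  have conj: "quadratic_conjugates \<epsilon> \<epsilon>'"
    unfolding \<epsilon>'_def using \<open>q \<noteq> 0\<close> root irrational by (rule quadratic_conjugates_of_int)
  have "of_int q * \<epsilon>' = - of_int (p - S LC) - of_int q * \<epsilon>"
    using \<open>q \<noteq> 0\<close> by (simp add: \<epsilon>'_def field_simps)
  then have "of_int q * (of_int q * \<epsilon>'\<^sup>2 + of_int (p - S LC) * \<epsilon>' + of_int (W LC)) =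
      of_int q * (of_int q * \<epsilon>\<^sup>2 + of_int (p - S LC) * \<epsilon> + of_int (W LC))"
    by algebra
  then have root': "of_int q * \<epsilon>'\<^sup>2 + of_int (p - S LC) * \<epsilon>' + of_int (W LC) = 0"
    using root \<open>q \<noteq> 0\<close> by simp
  \<comment> \<open>The \<open>LC\<close> entry is the quadratic equation for
    \<open>\<epsilon>'\<close>. The other entries follow from the definitions of \<open>p\<close>
    and \<open>q\<close> and from additivity.\<close>
  have eigen': "weight (displacement \<epsilon>') (\<psi> [X]) = (of_int p + of_int q * \<epsilon>') * displacement \<epsilon>' X" for X
    using root' by (cases X) (auto simp: image WB SB p_def q_def power2_eq_square algebra_simps)

  have occurs: "\<exists>n. u !! n = X" for X
  proof -
    obtain m where "\<psi> (stake 1 u) = stake m u"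
      using \<psi>(2) unfolding preserves_prefixes_def by metis
    then have "X \<in> set (stake m u)"
      using positive[of X "shd u"] by simp
    then show ?thesis
      by (auto simp: in_set_conv_nth)
  qed
  \<comment> \<open>Every image contains at least two distinct letters, so lengths at least double
    with each iteration.\<close>
  have growth: "k < length ((\<psi> ^^ k) [X])" for k X
  proof -
    have "card {LA, LB} \<le> card (set (\<psi> [X]))" for X
      by (intro card_mono) (auto simp: positive)
    then have two: "2 \<le> length (\<psi> [X])" for X
      using card_length[of "\<psi> [X]"] le_trans by fastforce
    have double: "2 * length w \<le> length (\<psi> w)" for w
    proof (induction w)
      case (Cons a w)
      then show ?case
        using two[of a] by (simp add: substitution_eq_concat[OF \<psi>(1), of w] substitution_eq_concat[OF \<psi>(1), of "a # w"])
    qed simp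
    have "2 ^ k \<le> length ((\<psi> ^^ k) [X])"
    proof (induction k)
      case (Suc k)
      then show ?case
        using double[of "(\<psi> ^^ k) [X]"] by simp
    qed simp
    then show ?thesis
      using less_exp[of k] by linarith
  qed
  have bound: "\<bar>weight (displacement \<epsilon>) ((\<psi> ^^ k) [X])\<bar> < 1" for k X
    using occurs letter_image_displacement substitution_funpow preserves_prefixes_funpow \<psi> by metis
  have "\<epsilon> \<noteq> \<epsilon>'"
    using conj by (simp add: quadratic_conjugates_def)
  then obtain k :: nat where "1 / \<bar>\<epsilon> - \<epsilon>'\<bar> < k"
    using reals_Archimedean2 by blast
  then have k: "1 < \<bar>\<epsilon> - \<epsilon>'\<bar> * real k"
    using \<open>\<epsilon> \<noteq> \<epsilon>'\<close> by (simp add: field_simps)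
  define r where "r = (of_int p + of_int q * \<epsilon>') ^ k"
  \<comment> \<open>Replacing \<open>\<epsilon>\<close> by \<open>\<epsilon>'\<close> changes the
    weight by \<open>(\<epsilon> - \<epsilon>') * N\<close>, of modulus above 1, while the original
    weight has modulus below 1. Hence \<open>r * displacement \<epsilon>' X\<close> has the sign of
    \<open>\<epsilon> - \<epsilon>'\<close> for every letter.\<close>
  have sign: "0 < r * displacement \<epsilon>' X * (\<epsilon> - \<epsilon>')" for X
  proof -
    define N where "N = real (weight steps ((\<psi> ^^ k) [X]))"
    have "real k < N"
      using growth[of k X] length_le_weight_steps[of "(\<psi> ^^ k) [X]"] by (simp add: N_def)
    then have "1 < \<bar>\<epsilon> - \<epsilon>'\<bar> * N"
      using k by (smt (verit) mult_left_mono abs_ge_zero)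
    moreover have "(\<epsilon>' - \<epsilon>) * N = - ((\<epsilon> - \<epsilon>') * N)"
      by algebra
    moreover have "r * displacement \<epsilon>' X = weight (displacement \<epsilon>) ((\<psi> ^^ k) [X]) + (\<epsilon> - \<epsilon>') * N"
      unfolding r_def weight_eigenvector[OF \<psi>(1) eigen', symmetric]
      by (simp add: weight_displacement N_def algebra_simps)
    ultimately show ?thesis
      using bound[of k X] \<open>\<epsilon> \<noteq> \<epsilon>'\<close>
      by (cases "\<epsilon> < \<epsilon>'") (auto simp: zero_less_mult_iff abs_if split: if_splits)
  qed
  have "\<epsilon>' \<notin> {0<..<1}"
  proof
    assume "\<epsilon>' \<in> {0<..<1}"
    then show False
      using sign[of LA] sign[of LC] by (auto simp: zero_less_mult_iff mult_less_0_iff)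
  qed
  then show ?thesis
    using conj \<epsilon> by (auto simp: sturm_number_def)
qed

end

theorem theoremB:
  fixes \<epsilon> l c :: real
    and u :: "letter stream"
    and \<phi> :: "letter list \<Rightarrow> letter list"
  assumes "0 < \<epsilon>" and "\<epsilon> < 1"
    and "max \<epsilon> (1 - \<epsilon>) < l" and "l < 1"
    and "- l < c" and "c \<le> 0"
    and "\<epsilon> \<notin> \<rat>"
    and "l \<notin> {of_int a + of_int b * \<epsilon> | a b. True}"
    and "is_3iet_word \<epsilon> l c u"
    and "primitive_substitution \<phi>"
    and "subst_stream \<phi> u = u"
  shows "sturm_number \<epsilon>"
proof -
  interpret nondegenerate_3iet_word \<epsilon> l c u
    by unfold_locales (use assms in auto)
  have \<phi>: "substitution \<phi>"
    using assms by (simp add: primitive_substitution_def)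
  obtain k where "\<And>i j. j \<in> set ((\<phi> ^^ k) [i])"
    using primitive_substitutionE[OF assms(10)] by blast
  then show ?thesis
    using positive_substitution_imp_sturm_number[OF substitution_funpow[OF \<phi>]
        preserves_prefixes_funpow[OF fixed_point_preserves_prefixes[OF \<phi> assms(11)]]]
    by blast
qed

end
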